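(* Let $\mathfrak{h}=\mathfrak{h}_1\oplus\mathfrak{h}_2$ be a finite-dimensional complex Hilbert space, with $1_{\mathfrak{h}_1},1_{\mathfrak{h}_2}$ the orthogonal projectors onto $\mathfrak{h}_1,\mathfrak{h}_2$. Let $h_1,h_2$ be self-adjoint operators on $\mathfrak{h}_1,\mathfrak{h}_2$ respectively, let $\beta>0$ and $\mu_1,\mu_2\in\mathbb{R}$, and let $$n=\Big(e^{\beta(h_1-\mu_1 1_{\mathfrak{h}_1})}\,e^{\beta(h_2-\mu_2 1_{\mathfrak{h}_2})}+1\Big)^{-1}$$ where $h_1,h_2$ are extended by $0$ to $\mathfrak{h}$. Let $S$ be a unitary operator on $\mathfrak{h}$ with $[S,h_1\oplus h_2]=0$. Assume there is an anti-unitary operator $T$ on $\mathfrak{h}$ with $T^2=1$ that leaves each of $\mathfrak{h}_1,\mathfrak{h}_2$ invariant and satisfies $T h_1 T=h_1$, $T h_2T=h_2$ and $TST=S^*$. For $\kappa\in\mathbb{C}$ define $$F(\kappa)=\det\Big(1+n\big(S^*e^{-\kappa 1_{\mathfrak{h}_1}}S\,e^{\kappa 1_{\mathfrak{h}_1}}-1\big)\Big).$$ Then for all $\kappa\in\mathbb{C}$, $$F\big(-\kappa\,\beta(\mu_1-\mu_2)\big)=F\big(-(1-\kappa)\,\beta(\mu_1-\mu_2)\big).$$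
   Context: $F$ is the Lesovik-Levitov generating function of the charge transported into lead $1$ for non-interacting electrons. Here $\mathfrak{h}_1,\mathfrak{h}_2$ are the one-electron state spaces of two leads, $h_1,h_2$ the decoupled one-particle Hamiltonians, $\beta$ the inverse temperature, $\mu_1,\mu_2$ the chemical potentials, $n$ the Fermi-Dirac occupation number operator, and $S$ the scattering matrix. Since $h_i$ and $1_{\mathfrak{h}_i}$ are extended by $0$ to the other summand, the product $e^{\beta(h_1-\mu_1 1_{\mathfrak{h}_1})}e^{\beta(h_2-\mu_2 1_{\mathfrak{h}_2})}$ equals $e^{\beta(h_1-\mu_1)}\oplus e^{\beta(h_2-\mu_2)}$ on $\mathfrak{h}_1\oplus\mathfrak{h}_2$. An anti-unitary operator is an antilinear bijection $T$ with $\langle T\phi,T\psi\rangle=\overline{\langle\phi,\psi\rangle}$. *)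

theory Defs
  imports Complex_Main "Jordan_Normal_Form.Determinant"
begin

text \<open>
  Finite-dimensional complex Hilbert spaces, the zero space included. The inner product is
  conjugate-linear in its first argument; completeness is automatic in finite dimension.
\<close>

class scaleC =
  fixes scaleC :: "complex \<Rightarrow> 'a \<Rightarrow> 'a" (infixr "*\<^sub>C" 75)

class complex_inner = real_normed_vector + scaleC +
  fixes cinner :: "'a \<Rightarrow> 'a \<Rightarrow> complex"
  assumes scaleC_add_right: "c *\<^sub>C (x + y) = c *\<^sub>C x + c *\<^sub>C y"
    and scaleC_add_left: "(c + d) *\<^sub>C x = c *\<^sub>C x + d *\<^sub>C x"
    and scaleC_scaleC: "c *\<^sub>C d *\<^sub>C x = (c * d) *\<^sub>C x"
    and scaleC_one: "1 *\<^sub>C x = x"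
    and scaleR_scaleC: "r *\<^sub>R x = complex_of_real r *\<^sub>C x"
    and cinner_add_right: "cinner x (y + z) = cinner x y + cinner x z"
    and cinner_scaleC_right: "cinner x (c *\<^sub>C y) = c * cinner x y"
    and cinner_commute: "cinner y x = cnj (cinner x y)"
    and cinner_self: "cinner x x = complex_of_real ((norm x)\<^sup>2)"

class fd_complex_hilbert = complex_inner +
  assumes finite_spanning:
    "\<exists>B. finite B \<and> (\<forall>x. \<exists>c. x = (\<Sum>b\<in>B. c b *\<^sub>C b))"

global_interpretation complex_vector:
  vector_space "scaleC :: complex \<Rightarrow> 'a \<Rightarrow> 'a::complex_inner"
  by unfold_locales (simp_all add: scaleC_add_right scaleC_add_left scaleC_scaleC scaleC_one)

abbreviation clinear :: "('a::complex_inner \<Rightarrow> 'a) \<Rightarrow> bool" where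
  "clinear \<equiv> Vector_Spaces.linear scaleC scaleC"

definition cadjoint :: "('a::complex_inner \<Rightarrow> 'a) \<Rightarrow> 'a \<Rightarrow> 'a" where
  "cadjoint A = (SOME B. \<forall>x y. cinner (A x) y = cinner x (B y))"

definition unitary_op :: "('a::complex_inner \<Rightarrow> 'a) \<Rightarrow> bool" where
  "unitary_op U \<longleftrightarrow> clinear U \<and> cadjoint U \<circ> U = id \<and> U \<circ> cadjoint U = id"

definition antiunitary_op :: "('a::complex_inner \<Rightarrow> 'a) \<Rightarrow> bool" where
  "antiunitary_op T \<longleftrightarrow>
     bij T \<and>
     (\<forall>x y. T (x + y) = T x + T y) \<and>
     (\<forall>c x. T (c *\<^sub>C x) = cnj c *\<^sub>C T x) \<and>
     (\<forall>x y. cinner (T x) (T y) = cnj (cinner x y))"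

text \<open>The series converges pointwise; in finite dimension this is the usual operator exponential.\<close>

definition op_exp :: "('a::complex_inner \<Rightarrow> 'a) \<Rightarrow> 'a \<Rightarrow> 'a" where
  "op_exp A x = (\<Sum>k. (A ^^ k) x /\<^sub>R fact k)"

text \<open>
  The determinant of an operator is that of its matrix in an ordered basis; by similarity
  the choice is immaterial for linear operators. On the zero space it equals 1.
\<close>

definition ordered_basis :: "'a::complex_inner list \<Rightarrow> bool" where
  "ordered_basis bs \<longleftrightarrow>
     distinct bs \<and> complex_vector.independent (set bs) \<and> complex_vector.span (set bs) = UNIV"

definition op_matrix :: "'a::complex_inner list \<Rightarrow> ('a \<Rightarrow> 'a) \<Rightarrow> complex mat" where
  "op_matrix bs A = mat (length bs) (length bs)
     (\<lambda>(i, j). complex_vector.representation (set bs) (A (bs ! j)) (bs ! i))"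

definition op_det :: "('a::fd_complex_hilbert \<Rightarrow> 'a) \<Rightarrow> complex" where
  "op_det A = det (op_matrix (SOME bs. ordered_basis bs) A)"

definition orthogonal_sum :: "'a::complex_inner set \<Rightarrow> 'a set \<Rightarrow> bool" where
  "orthogonal_sum V W \<longleftrightarrow>
     complex_vector.subspace V \<and> complex_vector.subspace W \<and>
     (\<forall>x\<in>V. \<forall>y\<in>W. cinner x y = 0) \<and>
     (\<forall>z. \<exists>x\<in>V. \<exists>y\<in>W. z = x + y)"

definition orth_proj :: "'a::complex_inner set \<Rightarrow> 'a \<Rightarrow> 'a" where
  "orth_proj V x = (THE y. y \<in> V \<and> (\<forall>z\<in>V. cinner z (x - y) = 0))"

text \<open>A self-adjoint operator on the subspace \<open>V\<close>; its values off \<open>V\<close> are irrelevant.\<close>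

definition self_adjoint_on :: "'a::complex_inner set \<Rightarrow> ('a \<Rightarrow> 'a) \<Rightarrow> bool" where
  "self_adjoint_on V h \<longleftrightarrow>
     (\<forall>x\<in>V. h x \<in> V) \<and>
     (\<forall>x\<in>V. \<forall>y\<in>V. h (x + y) = h x + h y) \<and>
     (\<forall>c. \<forall>x\<in>V. h (c *\<^sub>C x) = c *\<^sub>C h x) \<and>
     (\<forall>x\<in>V. \<forall>y\<in>V. cinner (h x) y = cinner x (h y))"

definition extend_zero :: "'a::complex_inner set \<Rightarrow> ('a \<Rightarrow> 'a) \<Rightarrow> 'a \<Rightarrow> 'a" where
  "extend_zero V h x = h (orth_proj V x)"

definition gibbs_factor ::
  "'a::complex_inner set \<Rightarrow> ('a \<Rightarrow> 'a) \<Rightarrow> real \<Rightarrow> real \<Rightarrow> 'a \<Rightarrow> 'a" where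
  "gibbs_factor V h \<beta> \<mu> = op_exp (\<lambda>x. \<beta> *\<^sub>R (extend_zero V h x - \<mu> *\<^sub>R orth_proj V x))"

definition occupation ::
  "'a::complex_inner set \<Rightarrow> 'a set \<Rightarrow> ('a \<Rightarrow> 'a) \<Rightarrow> ('a \<Rightarrow> 'a) \<Rightarrow>
   real \<Rightarrow> real \<Rightarrow> real \<Rightarrow> 'a \<Rightarrow> 'a" where
  "occupation V1 V2 h1 h2 \<beta> \<mu>1 \<mu>2 =
     inv_into UNIV (\<lambda>x. gibbs_factor V1 h1 \<beta> \<mu>1 (gibbs_factor V2 h2 \<beta> \<mu>2 x) + x)"

definition levitov_gf ::
  "'a::fd_complex_hilbert set \<Rightarrow> ('a \<Rightarrow> 'a) \<Rightarrow> ('a \<Rightarrow> 'a) \<Rightarrow> complex \<Rightarrow> complex" where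
  "levitov_gf V1 n S \<kappa> =
     op_det (\<lambda>x. x + n (cadjoint S (op_exp (\<lambda>y. (- \<kappa>) *\<^sub>C orth_proj V1 y)
                          (S (op_exp (\<lambda>y. \<kappa> *\<^sub>C orth_proj V1 y) x))) - x))"

end

theory Submission imports Defs
  "HOL-Computational_Algebra.Fundamental_Theorem_Algebra"
begin

text \<open>
  Write \<open>P = 1\<^bsub>h\<^sub>1\<^esub>\<close>, \<open>E(z) = e\<^bsup>zP\<^esup>\<close>, \<open>a = \<beta>(\<mu>\<^sub>1 - \<mu>\<^sub>2)\<close>. The Gibbs factors multiply to
  \<open>K E(-a)\<close>, where \<open>K = e\<^bsup>\<beta>(h - \<mu>\<^sub>2)\<^esup>\<close> commutes with \<open>S\<close> and \<open>P\<close>, so for \<open>p + q = a\<close>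
  \<open>det (1 + K E(-a)) F(-p) = det (K E(-a) + S\<^sup>* E(p) S E(-p)) = det (1 + S\<^sup>* E(-p) S K E(-q))\<close>.
  Transposition with respect to the bilinear form \<open>b(x, y) = \<langle>T x, y\<rangle>\<close> keeps determinants and fixes
  \<open>S\<close>, \<open>K\<close> and \<open>E(z)\<close>; it turns the last operator into one that \<open>S\<close> conjugates to the same operator
  with \<open>p\<close> and \<open>q\<close> interchanged.
\<close>

subsection \<open>Linear operators and determinants\<close>

lemma clinear_iff:
  "clinear A \<longleftrightarrow> (\<forall>x y. A (x + y) = A x + A y) \<and> (\<forall>c x. A (c *\<^sub>C x) = c *\<^sub>C A x)"
  by (simp add: Vector_Spaces.linear_iff complex_vector.vector_space_axioms)

lemma clinearI:
  assumes "\<And>x y. A (x + y) = A x + A y" and "\<And>c x. A (c *\<^sub>C x) = c *\<^sub>C A x"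
  shows "clinear A"
  using assms by (simp add: clinear_iff)

lemma
  assumes "clinear A"
  shows clinear_add: "A (x + y) = A x + A y"
    and clinear_scaleC: "A (c *\<^sub>C x) = c *\<^sub>C A x"
    and clinear_zero: "A 0 = 0"
    and clinear_diff: "A (x - y) = A x - A y"
    and clinear_sum: "A (\<Sum>i\<in>I. f i) = (\<Sum>i\<in>I. A (f i))"
proof -
  interpret Vector_Spaces.linear scaleC scaleC A by (fact assms)
  show "A (x + y) = A x + A y" "A (c *\<^sub>C x) = c *\<^sub>C A x" "A 0 = 0" "A (x - y) = A x - A y"
    "A (\<Sum>i\<in>I. f i) = (\<Sum>i\<in>I. A (f i))"
    by (simp_all add: add scale diff sum)
qed

lemma clinear_compose: "clinear A \<Longrightarrow> clinear B \<Longrightarrow> clinear (\<lambda>x. A (B x))"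
  by (simp add: clinear_iff)

lemma clinear_plus: "clinear A \<Longrightarrow> clinear B \<Longrightarrow> clinear (\<lambda>x. A x + B x)"
  by (simp add: clinear_iff complex_vector.scale_right_distrib)

lemma clinear_minus: "clinear A \<Longrightarrow> clinear B \<Longrightarrow> clinear (\<lambda>x. A x - B x)"
  by (simp add: clinear_iff complex_vector.scale_right_diff_distrib)

lemma clinear_scale: "clinear A \<Longrightarrow> clinear (\<lambda>x. c *\<^sub>C A x)"
  by (simp add: clinear_iff complex_vector.scale_right_distrib mult.commute)

lemma clinear_ident: "clinear (\<lambda>x. x)"
  by (simp add: clinear_iff)

lemma clinear_eq_on_spanning:
  assumes "clinear A" "clinear B" "complex_vector.span X = UNIV" "\<And>v. v \<in> X \<Longrightarrow> A v = B v"
  shows "A x = B x"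
proof -
  have "x \<in> complex_vector.span X" using assms(3) by simp
  then show ?thesis
    by (induction rule: complex_vector.span_induct_alt)
      (use assms in \<open>simp_all add: clinear_zero clinear_add clinear_scaleC\<close>)
qed

text \<open>A finite spanning set contains a maximal independent subset, and that subset still
  spans. The lemma guarantees that the choice made in \<open>op_det\<close> is a genuine
  basis.\<close>

lemma ordered_basis_exists: "\<exists>bs :: 'a::fd_complex_hilbert list. ordered_basis bs"
proof -
  obtain B :: "'a set" where B: "finite B" "\<forall>x. \<exists>c. x = (\<Sum>b\<in>B. c b *\<^sub>C b)"
    using finite_spanning by blast
  have "x \<in> complex_vector.span B" for x
    using B(2)[rule_format, of x]
    by (auto intro: complex_vector.span_sum complex_vector.span_scale complex_vector.span_base)
  then have spB: "complex_vector.span B = UNIV" by blast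
  obtain C where C: "C \<subseteq> B" "complex_vector.independent C" "B \<subseteq> complex_vector.span C"
    using complex_vector.maximal_independent_subset[of B] by blast
  have "complex_vector.span C = UNIV"
    using spB complex_vector.span_mono[OF C(3)] by (simp add: complex_vector.span_span top.extremum_uniqueI)
  moreover obtain bs where "set bs = C" "distinct bs"
    using finite_distinct_list finite_subset[OF C(1) B(1)] by metis
  ultimately show ?thesis using C(2) by (auto simp: ordered_basis_def)
qed

lemma ordered_basis_finite_dimensional:
  "ordered_basis bs \<Longrightarrow> finite_dimensional_vector_space scaleC (set bs)"
  by unfold_locales (simp_all add: ordered_basis_def)

section \<open>Injectivity, surjectivity and inverses in finite dimension\<close>

lemma clinear_inj_imp_surj:
  fixes A :: "'a::fd_complex_hilbert \<Rightarrow> 'a"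
  assumes "clinear A" "inj A"
  shows "surj A"
proof -
  obtain bs :: "'a list" where "ordered_basis bs" using ordered_basis_exists by blast
  then interpret finite_dimensional_vector_space scaleC "set bs"
    by (rule ordered_basis_finite_dimensional)
  show ?thesis using linear_inj_imp_surj assms by blast
qed

lemma clinear_surj_imp_inj:
  fixes A :: "'a::fd_complex_hilbert \<Rightarrow> 'a"
  assumes "clinear A" "surj A"
  shows "inj A"
proof -
  obtain bs :: "'a list" where "ordered_basis bs" using ordered_basis_exists by blast
  then interpret finite_dimensional_vector_space scaleC "set bs"
    by (rule ordered_basis_finite_dimensional)
  show ?thesis using linear_surj_imp_inj assms by blast
qed

lemma clinear_inv:
  assumes "clinear A" "bij A"
  shows "clinear (inv_into UNIV A)"
proof -
  have [simp]: "A (inv_into UNIV A x) = x" for x using assms(2) by (simp add: bij_def surj_f_inv_f)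
  have [simp]: "inv_into UNIV A (A x) = x" for x using assms(2) by (simp add: bij_def)
  show ?thesis
  proof (rule clinearI)
    show "inv_into UNIV A (x + y) = inv_into UNIV A x + inv_into UNIV A y" for x y
      using arg_cong[OF clinear_add[OF assms(1), of "inv_into UNIV A x" "inv_into UNIV A y"], of "inv_into UNIV A"] by simp
    show "inv_into UNIV A (c *\<^sub>C x) = c *\<^sub>C inv_into UNIV A x" for c x
      using arg_cong[OF clinear_scaleC[OF assms(1), of c "inv_into UNIV A x"], of "inv_into UNIV A"] by simp
  qed
qed

section \<open>Coordinates, matrices and multiplicativity of the determinant\<close>

lemma ordered_basis_expansion:
  assumes "ordered_basis bs"
  shows "(\<Sum>k<length bs. complex_vector.representation (set bs) x (bs ! k) *\<^sub>C bs ! k) = x"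
proof -
  let ?r = "complex_vector.representation (set bs) x"
  have "x = (\<Sum>b\<in>set bs. ?r b *\<^sub>C b)"
    by (rule complex_vector.sum_representation_eq[symmetric])
      (use assms in \<open>auto simp: ordered_basis_def\<close>)
  also have "\<dots> = (\<Sum>k<length bs. ?r (bs ! k) *\<^sub>C bs ! k)"
    using assms by (intro sum.reindex_bij_betw[symmetric] bij_betw_nth)
      (auto simp: ordered_basis_def)
  finally show ?thesis by simp
qed

lemma representation_basis_nth:
  assumes "ordered_basis bs" "i < length bs" "j < length bs"
  shows "complex_vector.representation (set bs) (bs ! i) (bs ! j) = (if i = j then 1 else 0)"
  using assms by (auto simp: ordered_basis_def complex_vector.representation_basis nth_eq_iff_index_eq)

lemma representation_sum_nth:
  assumes "ordered_basis bs" "i < length bs"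
  shows "complex_vector.representation (set bs) (\<Sum>k<length bs. c k *\<^sub>C bs ! k) (bs ! i) = c i"
proof -
  have *: "complex_vector.independent (set bs)" "\<And>v. v \<in> complex_vector.span (set bs)"
    using assms by (auto simp: ordered_basis_def)
  have "complex_vector.representation (set bs) (\<Sum>k<length bs. c k *\<^sub>C bs ! k) (bs ! i)
      = (\<Sum>k<length bs. c k * complex_vector.representation (set bs) (bs ! k) (bs ! i))"
    using * by (simp add: complex_vector.representation_sum complex_vector.representation_scale)
  also have "\<dots> = (\<Sum>k<length bs. if k = i then c k else 0)"
    by (rule sum.cong) (use assms in \<open>auto simp: representation_basis_nth\<close>)
  also have "\<dots> = c i" using assms by simp
  finally show ?thesis .
qed

text \<open>Linearity moves \<open>A\<close> inside the basis expansion of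
  \<open>B (bs ! j)\<close>; reading off the coordinate at \<open>bs ! i\<close> gives the matrix
  product.\<close>

lemma op_matrix_compose:
  assumes bs: "ordered_basis bs" and A: "clinear A"
  shows "op_matrix bs (\<lambda>x. A (B x)) = op_matrix bs A * op_matrix bs B"
proof (rule eq_matI)
  let ?r = "complex_vector.representation (set bs)"
  fix i j assume "i < dim_row (op_matrix bs A * op_matrix bs B)"
    "j < dim_col (op_matrix bs A * op_matrix bs B)"
  then have ij: "i < length bs" "j < length bs" by (simp_all add: op_matrix_def)
  have *: "complex_vector.independent (set bs)" "\<And>v. v \<in> complex_vector.span (set bs)"
    using bs by (auto simp: ordered_basis_def)
  have "A (B (bs ! j)) = (\<Sum>k<length bs. ?r (B (bs ! j)) (bs ! k) *\<^sub>C A (bs ! k))"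
    using arg_cong[OF ordered_basis_expansion[OF bs, of "B (bs ! j)"], of A]
    by (simp add: clinear_sum[OF A] clinear_scaleC[OF A])
  then have "?r (A (B (bs ! j))) (bs ! i)
      = (\<Sum>k<length bs. ?r (B (bs ! j)) (bs ! k) * ?r (A (bs ! k)) (bs ! i))"
    using * by (simp add: complex_vector.representation_sum complex_vector.representation_scale)
  then show "op_matrix bs (\<lambda>x. A (B x)) $$ (i, j) = (op_matrix bs A * op_matrix bs B) $$ (i, j)"
    using ij by (simp add: op_matrix_def scalar_prod_def lessThan_atLeast0 mult.commute)
qed (simp_all add: op_matrix_def)

lemma op_matrix_ident: "ordered_basis bs \<Longrightarrow> op_matrix bs (\<lambda>x. x) = 1\<^sub>m (length bs)"
  by (rule eq_matI) (auto simp: op_matrix_def representation_basis_nth)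

lemma op_matrix_carrier: "op_matrix bs A \<in> carrier_mat (length bs) (length bs)"
  by (simp add: op_matrix_def)

lemma chosen_ordered_basis: "ordered_basis (SOME bs :: 'a::fd_complex_hilbert list. ordered_basis bs)"
  using ordered_basis_exists by (rule someI_ex)

lemma op_det_compose: "clinear A \<Longrightarrow> op_det (\<lambda>x. A (B x)) = op_det A * op_det B"
  unfolding op_det_def
  by (simp add: op_matrix_compose[OF chosen_ordered_basis] det_mult[OF op_matrix_carrier op_matrix_carrier])

lemma op_det_ident: "op_det (\<lambda>x. x) = 1"
  by (simp add: op_det_def op_matrix_ident[OF chosen_ordered_basis])

lemma op_det_nonzero:
  assumes "clinear A" "bij A"
  shows "op_det A \<noteq> 0"
proof -
  have "op_det A * op_det (inv_into UNIV A) = op_det (\<lambda>x. A (inv_into UNIV A x))"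
    using assms by (simp add: op_det_compose)
  also have "\<dots> = 1"
    using assms(2) by (simp add: bij_def surj_f_inv_f op_det_ident)
  finally show ?thesis by auto
qed

text \<open>The matrix of this operator in \<open>bs\<close> is the Gram matrix of \<open>b\<close>.
  As an operator, it is invertible as soon as its kernel is zero.\<close>

definition gram_op :: "'a::complex_inner list \<Rightarrow> ('a \<Rightarrow> 'a \<Rightarrow> complex) \<Rightarrow> 'a \<Rightarrow> 'a" where
  "gram_op bs b y = (\<Sum>k<length bs. b (bs ! k) y *\<^sub>C bs ! k)"

lemma clinear_gram_op:
  assumes "\<And>x y z. b x (y + z) = b x y + b x z" "\<And>x c y. b x (c *\<^sub>C y) = c * b x y"
  shows "clinear (gram_op bs b)"
  by (rule clinearI) (simp_all add: gram_op_def assms complex_vector.scale_left_distrib sum.distrib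
    complex_vector.scale_sum_right)

text \<open>The coordinates of \<open>gram_op bs b y\<close> are the values
  \<open>b (bs ! k) y\<close>, so its kernel consists of the vectors annihilated by the basis.
  Linearity is asked of the second argument alone, so that the lemma serves both the sesquilinear
  \<open>cinner\<close> and bilinear forms.\<close>

lemma bij_gram_op:
  fixes b :: "'a::fd_complex_hilbert \<Rightarrow> 'a \<Rightarrow> complex"
  assumes bs: "ordered_basis bs"
    and lin: "\<And>x y z. b x (y + z) = b x y + b x z" "\<And>x c y. b x (c *\<^sub>C y) = c * b x y"
    and nondeg: "\<And>y. (\<And>v. v \<in> set bs \<Longrightarrow> b v y = 0) \<Longrightarrow> y = 0"
  shows "bij (gram_op bs b)"
proof -
  note L = clinear_gram_op[of b, OF lin]
  have "y = 0" if "gram_op bs b y = 0" for y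
  proof (rule nondeg)
    fix v assume "v \<in> set bs"
    then obtain i where i: "i < length bs" "v = bs ! i" by (auto simp: in_set_conv_nth)
    show "b v y = 0"
      using representation_sum_nth[OF bs i(1), of "\<lambda>k. b (bs ! k) y"] that i(2)
      by (simp add: gram_op_def complex_vector.representation_zero)
  qed
  then have "inj (gram_op bs b)"
    by (metis (no_types, lifting) injI clinear_diff[OF L] eq_iff_diff_eq_0)
  then show ?thesis using clinear_inj_imp_surj[OF L] by (simp add: bij_def)
qed

text \<open>The model is \<open>cinner (T x) y\<close> with \<open>T\<close> anti-unitary. Such a
  form is complex bilinear, so transposition with respect to it leaves determinants unconjugated,
  whereas the adjoint would conjugate them.\<close>

locale nondegenerate_form =
  fixes b :: "'a::fd_complex_hilbert \<Rightarrow> 'a \<Rightarrow> complex"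
  assumes lin: "\<And>x y z. b x (y + z) = b x y + b x z" "\<And>x c y. b x (c *\<^sub>C y) = c * b x y"
    and lin': "\<And>x y z. b (x + y) z = b x z + b y z" "\<And>x c y. b (c *\<^sub>C x) y = c * b x y"
    and nondeg: "\<And>y. (\<And>x. b x y = 0) \<Longrightarrow> y = 0"
begin

lemma zero_left: "b 0 y = 0"
  using lin'(2)[of 0 0 y] by simp

lemma zero_right: "b x 0 = 0"
  using lin(2)[of x 0 0] by simp

text \<open>With the Gram operator \<open>L\<close> of \<open>b\<close>, the hypothesis reads \<open>M(A')\<^sup>T M(L) = M(L) M(A)\<close> in matrices.\<close>

lemma op_det_transpose:
  assumes A: "clinear A"
    and adj: "\<And>x y. b (A' x) y = b x (A y)"
  shows "op_det A' = op_det A"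
proof -
  define bs :: "'a list" where "bs = (SOME bs. ordered_basis bs)"
  have bs: "ordered_basis bs" unfolding bs_def by (rule chosen_ordered_basis)
  let ?r = "complex_vector.representation (set bs)"
  define L where "L = gram_op bs b"
  have L: "clinear L" unfolding L_def by (rule clinear_gram_op[OF lin])
  have bsum: "b (\<Sum>k\<in>I. f k) y = (\<Sum>k\<in>I. b (f k) y)" for I :: "nat set" and f y
    by (induction I rule: infinite_finite_induct) (simp_all add: lin' zero_left)
  have "bij L" unfolding L_def
  proof (rule bij_gram_op[OF bs lin])
    fix y assume *: "\<And>v. v \<in> set bs \<Longrightarrow> b v y = 0"
    show "y = 0"
    proof (rule nondeg)
      fix x
      show "b x y = 0"
        by (subst ordered_basis_expansion[OF bs, of x, symmetric]) (simp add: bsum lin' *)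
    qed
  qed
  then have detL: "det (op_matrix bs L) \<noteq> 0"
    using op_det_nonzero[OF L] by (simp add: op_det_def bs_def)
  let ?A = "op_matrix bs A" and ?A' = "op_matrix bs A'" and ?L = "op_matrix bs L"
  have "?A'\<^sup>T * ?L = ?L * ?A"
    unfolding op_matrix_compose[OF bs L, symmetric]
  proof (rule eq_matI)
    fix i j assume "i < dim_row (op_matrix bs (\<lambda>x. L (A x)))" "j < dim_col (op_matrix bs (\<lambda>x. L (A x)))"
    then have ij: "i < length bs" "j < length bs" by (simp_all add: op_matrix_def)
    have "b (bs ! i) (A (bs ! j)) = b (A' (bs ! i)) (bs ! j)" by (simp add: adj)
    also have "\<dots> = (\<Sum>k<length bs. ?r (A' (bs ! i)) (bs ! k) * b (bs ! k) (bs ! j))"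
      by (subst ordered_basis_expansion[OF bs, of "A' (bs ! i)", symmetric]) (simp add: bsum lin')
    finally show "(?A'\<^sup>T * ?L) $$ (i, j) = op_matrix bs (\<lambda>x. L (A x)) $$ (i, j)"
      using ij by (simp add: op_matrix_def scalar_prod_def lessThan_atLeast0 L_def gram_op_def
        representation_sum_nth[OF bs, unfolded lessThan_atLeast0])
  qed (simp_all add: op_matrix_def)
  then have "det (?A'\<^sup>T) * det ?L = det ?L * det ?A"
    by (metis det_mult op_matrix_carrier transpose_carrier_mat)
  then show ?thesis
    using detL by (simp add: op_det_def bs_def det_transpose[OF op_matrix_carrier])
qed

end

subsection \<open>The adjoint\<close>

lemma cinner_zero_right [simp]: "cinner x 0 = 0"
  using cinner_scaleC_right[of x 0 0] by simp

lemma cinner_zero_left [simp]: "cinner 0 x = 0"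
  using cinner_commute[of 0 x] by simp

lemma cinner_add_left: "cinner (x + y) z = cinner x z + cinner y z"
  by (metis cinner_add_right cinner_commute complex_cnj_add)

lemma cinner_scaleC_left: "cinner (c *\<^sub>C x) y = cnj c * cinner x y"
  by (metis cinner_scaleC_right cinner_commute complex_cnj_mult)

lemma cinner_diff_right: "cinner x (y - z) = cinner x y - cinner x z"
  by (metis add_diff_cancel cinner_add_right diff_add_cancel)

lemma cinner_diff_left: "cinner (x - y) z = cinner x z - cinner y z"
  by (metis add_diff_cancel cinner_add_left diff_add_cancel)

lemma cinner_self_eq_0 [simp]: "cinner x x = 0 \<longleftrightarrow> x = 0"
  by (simp add: cinner_self)

lemma cinner_eq_0_on_spanning:
  assumes "complex_vector.span X = UNIV" "\<And>v. v \<in> X \<Longrightarrow> cinner v y = 0"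
  shows "cinner x y = 0"
proof -
  have "x \<in> complex_vector.span X" using assms(1) by simp
  then show ?thesis
    by (induction rule: complex_vector.span_induct_alt)
      (simp_all add: assms cinner_add_left cinner_scaleC_left)
qed

text \<open>The conditions on \<open>z\<close> for \<open>x\<close> in a basis form a linear system
  whose matrix is the Gram matrix of \<open>cinner\<close>, hence solvable. Both sides are
  conjugate-linear in \<open>x\<close>, so agreement on the basis suffices.\<close>

lemma adjoint_exists:
  fixes A :: "'a::fd_complex_hilbert \<Rightarrow> 'a"
  assumes A: "clinear A"
  shows "\<exists>z. \<forall>x. cinner (A x) y = cinner x z"
proof -
  obtain bs :: "'a list" where bs: "ordered_basis bs" using ordered_basis_exists by blast
  then have sp: "complex_vector.span (set bs) = UNIV" by (simp add: ordered_basis_def)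
  have "bij (gram_op bs cinner)"
  proof (rule bij_gram_op[OF bs cinner_add_right cinner_scaleC_right])
    fix y assume "\<And>v. v \<in> set bs \<Longrightarrow> cinner v y = 0"
    then have "cinner y y = 0" using cinner_eq_0_on_spanning[OF sp] by blast
    then show "y = 0" by simp
  qed
  then obtain z where z: "gram_op bs cinner z = (\<Sum>k<length bs. cinner (A (bs ! k)) y *\<^sub>C bs ! k)"
    by (metis bij_def surjD)
  have eq: "cinner v z = cinner (A v) y" if v: "v \<in> set bs" for v
  proof -
    obtain i where i: "i < length bs" "v = bs ! i" using v by (auto simp: in_set_conv_nth)
    show ?thesis
      using representation_sum_nth[OF bs i(1), of "\<lambda>k. cinner (bs ! k) z"]
        representation_sum_nth[OF bs i(1), of "\<lambda>k. cinner (A (bs ! k)) y"] z i(2)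
      by (simp add: gram_op_def)
  qed
  have "cinner (A x) y = cinner x z" for x
  proof -
    have "x \<in> complex_vector.span (set bs)" using sp by simp
    then show ?thesis
      by (induction rule: complex_vector.span_induct_alt)
        (simp_all add: eq cinner_add_left cinner_scaleC_left clinear_zero[OF A] clinear_add[OF A]
          clinear_scaleC[OF A])
  qed
  then show ?thesis by blast
qed

text \<open>Collecting the vectors from \<open>adjoint_exists\<close>, one for each
  \<open>y\<close>, gives a function with the defining property, so the choice in
  \<open>cadjoint\<close> has that property too.\<close>

lemma cinner_cadjoint:
  fixes A :: "'a::fd_complex_hilbert \<Rightarrow> 'a"
  assumes "clinear A"
  shows "cinner (A x) y = cinner x (cadjoint A y)"
proof -
  have "\<exists>B. \<forall>x y. cinner (A x) y = cinner x (B y)"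
    using adjoint_exists[OF assms] by metis
  then have "\<forall>x y. cinner (A x) y = cinner x (cadjoint A y)"
    unfolding cadjoint_def by (rule someI_ex)
  then show ?thesis by blast
qed

subsection \<open>Self-adjoint operators are diagonalizable\<close>

definition poly_op :: "('a::complex_inner \<Rightarrow> 'a) \<Rightarrow> complex poly \<Rightarrow> 'a \<Rightarrow> 'a" where
  "poly_op A p x = (\<Sum>i\<le>degree p. coeff p i *\<^sub>C (A ^^ i) x)"

lemma poly_op_bound:
  assumes "degree p \<le> N"
  shows "poly_op A p x = (\<Sum>i\<le>N. coeff p i *\<^sub>C (A ^^ i) x)"
  unfolding poly_op_def
  by (rule sum.mono_neutral_left) (use assms in \<open>auto simp: coeff_eq_0\<close>)

lemma poly_op_add: "poly_op A (p + q) x = poly_op A p x + poly_op A q x"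
proof -
  let ?N = "max (degree p) (degree q)"
  have "degree (p + q) \<le> ?N" by (rule degree_add_le_max)
  then show ?thesis
    by (simp add: poly_op_bound[of _ ?N] complex_vector.scale_left_distrib sum.distrib)
qed

lemma poly_op_smult: "poly_op A (smult c p) x = c *\<^sub>C poly_op A p x"
  by (simp add: poly_op_bound[of _ "degree p"] complex_vector.scale_sum_right degree_smult_le)

lemma poly_op_pCons_0: "poly_op A (pCons 0 p) x = poly_op A p (A x)"
proof -
  have "degree (pCons 0 p) \<le> Suc (degree p)" by (rule degree_pCons_le)
  then have "poly_op A (pCons 0 p) x = (\<Sum>i\<le>Suc (degree p). coeff (pCons 0 p) i *\<^sub>C (A ^^ i) x)"
    by (rule poly_op_bound)
  also have "\<dots> = poly_op A p (A x)"
    unfolding sum.atMost_Suc_shift by (simp add: poly_op_def funpow_swap1)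
  finally show ?thesis .
qed

lemma clinear_funpow: "clinear A \<Longrightarrow> clinear (A ^^ k)"
  by (induction k) (simp_all add: clinear_iff)

lemma clinear_poly_op:
  assumes "clinear A"
  shows "clinear (poly_op A p)"
  using clinear_funpow[OF assms]
  by (intro clinearI) (simp_all add: poly_op_def clinear_add clinear_scaleC sum.distrib
    complex_vector.scale_right_distrib complex_vector.scale_sum_right mult.commute)

text \<open>This trades a root of the annihilating polynomial for a passage from \<open>x\<close> to
  \<open>A x - l x\<close>, which lowers the degree by one.\<close>

lemma poly_op_linear_factor:
  assumes "clinear A"
  shows "poly_op A ([:- l, 1:] * q) x = poly_op A q (A x - l *\<^sub>C x)"
proof -
  have "[:- l, 1:] * q = smult (- l) q + pCons 0 q" by simp
  then show ?thesis
    by (simp only: poly_op_add poly_op_smult poly_op_pCons_0)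
      (simp add: clinear_diff[OF clinear_poly_op[OF assms]] clinear_scaleC[OF clinear_poly_op[OF assms]])
qed

text \<open>In dimension \<open>N\<close> the \<open>N + 1\<close> vectors
  \<open>x, A x, ..., A^N x\<close> satisfy a nontrivial linear relation, whose coefficients are
  those of \<open>p\<close>.\<close>

lemma annihilating_poly_exists:
  fixes A :: "'a::fd_complex_hilbert \<Rightarrow> 'a"
  shows "\<exists>p. p \<noteq> 0 \<and> poly_op A p x = 0"
proof -
  obtain bs :: "'a list" where "ordered_basis bs" using ordered_basis_exists by blast
  then interpret finite_dimensional_vector_space scaleC "set bs"
    by (rule ordered_basis_finite_dimensional)
  define N where "N = card (set bs)"
  let ?f = "\<lambda>i. (A ^^ i) x"
  have "\<exists>c. (\<exists>i\<le>N. c i \<noteq> (0::complex)) \<and> (\<Sum>i\<le>N. c i *\<^sub>C ?f i) = 0"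
  \<comment> \<open>Dependence is a property of sets, in which repeated iterates collapse. A
    repetition is therefore treated separately; it gives the relation
    \<open>A^i x - A^j x = 0\<close>.\<close>
  proof (cases "inj_on ?f {..N}")
    case True
    then have "card (?f ` {..N}) = Suc N" by (simp add: card_image)
    moreover have "card X \<le> N" if "complex_vector.independent X" for X :: "'a set"
      using independent_card_le_dim[of X UNIV] that by (simp add: N_def)
    ultimately have "complex_vector.dependent (?f ` {..N})" by fastforce
    then obtain u where u: "\<exists>v\<in>?f ` {..N}. u v \<noteq> 0" "(\<Sum>v\<in>?f ` {..N}. u v *\<^sub>C v) = 0"
      by (subst (asm) complex_vector.dependent_finite) auto
    then show ?thesis
      by (intro exI[of _ "\<lambda>i. u (?f i)"]) (auto simp: sum.reindex[OF True])
  next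
    case False
    then obtain i j where ij: "i \<le> N" "j \<le> N" "i \<noteq> j" "?f i = ?f j"
      by (auto simp: inj_on_def)
    have "(\<Sum>k\<le>N. (if k = i then 1 else if k = j then - 1 else 0) *\<^sub>C ?f k)
        = (\<Sum>k\<in>{i, j}. (if k = i then 1 else if k = j then - 1 else 0) *\<^sub>C ?f k)"
      by (rule sum.mono_neutral_right) (use ij in auto)
    also have "\<dots> = 0" using ij by simp
    finally show ?thesis
      using ij(1) by (intro exI[of _ "\<lambda>k. if k = i then 1 else if k = j then - 1 else 0"]) auto
  qed
  then obtain c i where c: "i \<le> N" "c i \<noteq> (0::complex)" "(\<Sum>i\<le>N. c i *\<^sub>C ?f i) = 0" by blast
  define p where "p = (\<Sum>k\<le>N. monom (c k) k)"
  have cf: "coeff p k = (if k \<le> N then c k else 0)" for k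
    by (simp add: p_def coeff_sum)
  have "p \<noteq> 0" using c cf by (metis coeff_0)
  moreover have "degree p \<le> N" by (rule degree_le) (simp add: cf)
  then have "poly_op A p x = 0" using c(3) by (simp add: poly_op_bound[of _ N] cf)
  ultimately show ?thesis by blast
qed

text \<open>By induction on the degree of a polynomial annihilating \<open>x\<close>: with \<open>l\<close> one of its roots,
  \<open>H x - l x\<close> lies in the span of eigenvectors, hence equals \<open>(H z - l z) + u\<close> with \<open>z\<close> in the span and
  \<open>H u = l u\<close>; self-adjointness forces \<open>u = 0\<close>, so \<open>x - z\<close> is an eigenvector.\<close>

lemma self_adjoint_span_eigenvectors:
  fixes H :: "'a::fd_complex_hilbert \<Rightarrow> 'a"
  assumes H: "clinear H" and sym: "\<And>x y. cinner (H x) y = cinner x (H y)"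
  shows "complex_vector.span {v. \<exists>l::real. H v = complex_of_real l *\<^sub>C v} = UNIV"
    (is "complex_vector.span ?E = UNIV")
proof -
  have eigen: "v \<in> ?E" if v: "H v = l *\<^sub>C v" for v l
  proof (cases "v = 0")
    case True
    then show ?thesis by (simp add: clinear_zero[OF H])
  next
    case False
    have "cnj l * cinner v v = l * cinner v v"
      using sym[of v v] by (simp add: v cinner_scaleC_left cinner_scaleC_right)
    then have "cnj l = l" using False by simp
    then have "l = complex_of_real (Re l)" by (simp add: complex_eq_iff)
    then show ?thesis using v by auto
  qed
  have semisimple: "u = 0" if w: "H w - l *\<^sub>C w = u" and u: "H u = l *\<^sub>C u" for w u l
  proof (rule ccontr)
    assume "u \<noteq> 0"
    moreover have "cnj l * cinner u u = l * cinner u u"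
      using sym[of u u] by (simp add: u cinner_scaleC_left cinner_scaleC_right)
    ultimately have l: "cnj l = l" by simp
    \<comment> \<open>Since \<open>l\<close> is real, \<open>H - l\<close> moves to the other
      argument of the inner product, where it kills \<open>u\<close>.\<close>
    have "cinner u u = cinner (H w) u - cinner (l *\<^sub>C w) u"
      by (metis w cinner_diff_left)
    also have "\<dots> = 0" by (simp add: sym u cinner_scaleC_left cinner_scaleC_right l)
    finally show False using \<open>u \<noteq> 0\<close> by simp
  qed
  have "x \<in> complex_vector.span ?E" if "degree p = n" "p \<noteq> 0" "poly_op H p x = 0" for p n x
    using that
  proof (induction n arbitrary: p x)
    case 0
    then obtain c where "p = [:c:]" "c \<noteq> 0" by (metis degree_eq_zeroE pCons_0_0)
    then have "x = 0" using 0 by (simp add: poly_op_def)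
    then show ?case by (simp add: complex_vector.span_zero)
  next
    case (Suc n)
    obtain l where "poly p l = 0"
      using fundamental_theorem_of_algebra[of p] Suc.prems(1)
      by (metis constant_degree nat.distinct(1))
    then obtain q where q: "p = [:- l, 1:] * q" by (metis poly_eq_0_iff_dvd dvdE)
    with Suc.prems have "q \<noteq> 0" by auto
    then have "degree p = Suc (degree q)" unfolding q by (subst degree_mult_eq) auto
    then have "degree q = n" using Suc.prems(1) by simp
    moreover define y where "y = H x - l *\<^sub>C x"
    have "poly_op H q y = 0"
      using Suc.prems(3) unfolding q y_def poly_op_linear_factor[OF H] .
    ultimately have "y \<in> complex_vector.span ?E" using Suc.IH \<open>q \<noteq> 0\<close> by blast
    then have "\<exists>z u. z \<in> complex_vector.span ?E \<and> H u = l *\<^sub>C u \<and> y = (H z - l *\<^sub>C z) + u"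
    proof (induction rule: complex_vector.span_induct_alt)
      case base
      show ?case
        by (intro exI[of _ 0]) (simp add: complex_vector.span_zero clinear_zero[OF H])
    next
      case (step c v y)
      then obtain m z u where v: "H v = complex_of_real m *\<^sub>C v" and z: "z \<in> complex_vector.span ?E"
        and u: "H u = l *\<^sub>C u" and y: "y = (H z - l *\<^sub>C z) + u" by auto
      have vE: "v \<in> complex_vector.span ?E" using v by (auto intro: complex_vector.span_base)
      show ?case
      proof (cases "complex_of_real m = l")
        \<comment> \<open>Here \<open>H - l\<close> kills \<open>v\<close>, so the new term joins
          the eigenvector part \<open>u\<close>.\<close>
        case True
        have "H (c *\<^sub>C v + u) = l *\<^sub>C (c *\<^sub>C v + u)"
          using v u True by (simp add: clinear_add[OF H] clinear_scaleC[OF H]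
            complex_vector.scale_right_distrib mult.commute)
        then show ?thesis using z y by (intro exI[of _ z] exI[of _ "c *\<^sub>C v + u"]) simp
      next
        \<comment> \<open>On \<open>v\<close> the operator \<open>H - l\<close> is multiplication by
          \<open>m - l\<close>, which is nonzero, so dividing by it yields a preimage of
          \<open>c v\<close>.\<close>
        case False
        let ?d = "c / (complex_of_real m - l)"
        have "e * complex_of_real m - l * e = (complex_of_real m - l) * e" for e
          by (simp add: algebra_simps)
        from this[of ?d] have "?d * complex_of_real m - l * ?d = (complex_of_real m - l) * ?d" .
        also have "\<dots> = c" using False by simp
        finally have d: "?d * complex_of_real m - l * ?d = c" .
        define w where "w = ?d *\<^sub>C v"
        have "H w - l *\<^sub>C w = (?d * complex_of_real m - l * ?d) *\<^sub>C v"
          using v by (simp only: w_def clinear_scaleC[OF H] complex_vector.scale_scale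
            complex_vector.scale_left_diff_distrib)
        then have "c *\<^sub>C v = H w - l *\<^sub>C w" unfolding d by (rule HOL.sym)
        then have "c *\<^sub>C v + y = (H (w + z) - l *\<^sub>C (w + z)) + u"
          using y by (simp add: clinear_add[OF H] complex_vector.scale_right_distrib)
        moreover have "w + z \<in> complex_vector.span ?E"
          using vE z unfolding w_def by (intro complex_vector.span_add complex_vector.span_scale)
        ultimately show ?thesis using u by blast
      qed
    qed
    then obtain z u where z: "z \<in> complex_vector.span ?E" and u: "H u = l *\<^sub>C u"
      and y: "y = (H z - l *\<^sub>C z) + u" by blast
    have xz: "H (x - z) - l *\<^sub>C (x - z) = u"
      using y unfolding y_def
      by (simp add: clinear_diff[OF H] complex_vector.scale_right_diff_distrib algebra_simps)
    then have "u = 0" using semisimple u by blast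
    then have "x - z \<in> ?E" using xz by (intro eigen[of _ l]) simp
    then have "(x - z) + z \<in> complex_vector.span ?E"
      using z by (rule complex_vector.span_add[OF complex_vector.span_base])
    then show ?case by simp
  qed
  then show ?thesis using annihilating_poly_exists[of H] by blast
qed

subsection \<open>Exponentials of diagonalizable operators\<close>

text \<open>Formulated through a spanning set of eigenvectors, so that statements about
  \<open>op_exp\<close> reduce by span induction to the scalar exponential series.\<close>

definition diagonalizable_op :: "('a::complex_inner \<Rightarrow> 'a) \<Rightarrow> bool" where
  "diagonalizable_op A \<longleftrightarrow> clinear A \<and> complex_vector.span {v. \<exists>l. A v = l *\<^sub>C v} = UNIV"

lemma diagonalizable_op_clinear: "diagonalizable_op A \<Longrightarrow> clinear A"
  by (simp add: diagonalizable_op_def)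

lemma diagonalizable_opI:
  assumes "clinear A" "complex_vector.span X = UNIV" "\<And>v. v \<in> X \<Longrightarrow> \<exists>l. A v = l *\<^sub>C v"
  shows "diagonalizable_op A"
proof -
  have "X \<subseteq> {v. \<exists>l. A v = l *\<^sub>C v}" using assms(3) by blast
  from complex_vector.span_mono[OF this] show ?thesis
    using assms(1,2) by (auto simp: diagonalizable_op_def)
qed

lemma diagonalizable_op_induct [consumes 1, case_names zero eigen]:
  assumes "diagonalizable_op A"
    and "P 0"
    and "\<And>c v y l. A v = l *\<^sub>C v \<Longrightarrow> P y \<Longrightarrow> P (c *\<^sub>C v + y)"
  shows "P x"
proof -
  have "x \<in> complex_vector.span {v. \<exists>l. A v = l *\<^sub>C v}"
    using assms(1) by (simp add: diagonalizable_op_def)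
  then show ?thesis
    by (induction rule: complex_vector.span_induct_alt) (use assms(2,3) in auto)
qed

text \<open>For non-real \<open>c\<close> the norm is tied to scalar multiplication through the
  inner product. The identity makes scalar multiplication continuous in each argument, as needed to
  multiply series termwise.\<close>

lemma norm_scaleC: "norm (c *\<^sub>C x) = cmod c * norm x" for x :: "'a::complex_inner"
proof -
  have "cinner (c *\<^sub>C x) (c *\<^sub>C x) = (c * cnj c) * cinner x x"
    by (simp add: cinner_scaleC_left cinner_scaleC_right)
  then have "complex_of_real ((norm (c *\<^sub>C x))\<^sup>2) = complex_of_real ((cmod c)\<^sup>2 * (norm x)\<^sup>2)"
    by (simp only: cinner_self complex_norm_square[symmetric] of_real_mult)
  then have "(norm (c *\<^sub>C x))\<^sup>2 = (cmod c * norm x)\<^sup>2"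
    by (simp only: of_real_eq_iff power_mult_distrib)
  then show ?thesis by (simp add: power2_eq_iff_nonneg)
qed

lemma bounded_linear_scaleC_left: "bounded_linear (\<lambda>c. c *\<^sub>C (x::'a::complex_inner))"
  by (rule bounded_linear_intro[of _ "norm x"])
    (simp_all add: complex_vector.scale_left_distrib scaleR_scaleC norm_scaleC scaleR_conv_of_real)

lemma bounded_linear_scaleC_right: "bounded_linear (\<lambda>x::'a::complex_inner. c *\<^sub>C x)"
  by (rule bounded_linear_intro[of _ "cmod c"])
    (simp_all add: complex_vector.scale_right_distrib scaleR_scaleC norm_scaleC mult.commute)

lemma op_exp_eigenvector_sums:
  assumes "clinear A" "A v = l *\<^sub>C v"
  shows "(\<lambda>k. (A ^^ k) v /\<^sub>R fact k) sums (exp l *\<^sub>C v)"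
proof -
  have "(A ^^ k) v = l ^ k *\<^sub>C v" for k
    by (induction k) (simp_all add: assms clinear_scaleC[OF assms(1)] mult.commute)
  then have "(A ^^ k) v /\<^sub>R fact k = (l ^ k /\<^sub>R fact k) *\<^sub>C v" for k
    by (simp add: scaleR_scaleC scaleR_conv_of_real)
  then show ?thesis
    using bounded_linear.sums[OF bounded_linear_scaleC_left exp_converges[of l]] by simp
qed

lemma op_exp_eigenvector: "clinear A \<Longrightarrow> A v = l *\<^sub>C v \<Longrightarrow> op_exp A v = exp l *\<^sub>C v"
  unfolding op_exp_def using op_exp_eigenvector_sums by (rule sums_unique[symmetric])

text \<open>The vectors at which the series converges form a subspace, and it contains every
  eigenvector.\<close>

lemma op_exp_sums:
  assumes A: "diagonalizable_op A"
  shows "(\<lambda>k. (A ^^ k) x /\<^sub>R fact k) sums op_exp A x"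
proof -
  note lin = diagonalizable_op_clinear[OF A]
  have "summable (\<lambda>k. (A ^^ k) x /\<^sub>R fact k)"
    using A
  proof (induction x rule: diagonalizable_op_induct)
    case zero
    show ?case by (simp add: clinear_zero[OF clinear_funpow[OF lin]])
  next
    case (eigen c v y l)
    have eq: "(A ^^ k) (c *\<^sub>C v + y) /\<^sub>R fact k
        = c *\<^sub>C ((A ^^ k) v /\<^sub>R fact k) + (A ^^ k) y /\<^sub>R fact k" for k
      using clinear_funpow[OF lin, of k]
      by (simp add: clinear_add clinear_scaleC scaleR_scaleC complex_vector.scale_right_distrib mult.commute)
    have "summable (\<lambda>k. (A ^^ k) v /\<^sub>R fact k)"
      using op_exp_eigenvector_sums[OF lin eigen(1)] by (rule sums_summable)
    then show ?case
      unfolding eq using eigen(2)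
      by (intro summable_add bounded_linear.summable[OF bounded_linear_scaleC_right])
  qed
  then show ?thesis unfolding op_exp_def by (rule summable_sums)
qed

lemma clinear_op_exp:
  assumes A: "diagonalizable_op A"
  shows "clinear (op_exp A)"
proof (rule clinearI)
  note pow = clinear_funpow[OF diagonalizable_op_clinear[OF A]]
  fix x y c
  have "(\<lambda>k. (A ^^ k) (x + y) /\<^sub>R fact k) sums (op_exp A x + op_exp A y)"
    using sums_add[OF op_exp_sums[OF A, of x] op_exp_sums[OF A, of y]]
    by (simp add: clinear_add[OF pow] scaleR_right_distrib)
  then show "op_exp A (x + y) = op_exp A x + op_exp A y"
    using op_exp_sums[OF A] sums_unique2 by blast
  have "(\<lambda>k. (A ^^ k) (c *\<^sub>C x) /\<^sub>R fact k) sums (c *\<^sub>C op_exp A x)"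
    using bounded_linear.sums[OF bounded_linear_scaleC_right op_exp_sums[OF A, of x], of c]
    by (simp add: clinear_scaleC[OF pow] scaleR_scaleC mult.commute)
  then show "op_exp A (c *\<^sub>C x) = c *\<^sub>C op_exp A x"
    using op_exp_sums[OF A] sums_unique2 by blast
qed

text \<open>\<open>C\<close> maps each eigenspace of \<open>A\<close> into itself, and there
  \<open>op_exp A\<close> is multiplication by a scalar.\<close>

lemma op_exp_commute:
  assumes A: "diagonalizable_op A" and C: "clinear C" and comm: "\<And>x. C (A x) = A (C x)"
  shows "C (op_exp A x) = op_exp A (C x)"
  using A
proof (induction x rule: diagonalizable_op_induct)
  case zero
  show ?case by (simp add: clinear_zero[OF C] clinear_zero[OF clinear_op_exp[OF A]])
next
  case (eigen c v y l)
  note lin = diagonalizable_op_clinear[OF A]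
  have "A (C v) = l *\<^sub>C C v" by (simp add: comm[symmetric] eigen(1) clinear_scaleC[OF C])
  then have "C (op_exp A v) = op_exp A (C v)"
    unfolding op_exp_eigenvector[OF lin eigen(1)]
    by (simp only: op_exp_eigenvector[OF lin, of "C v" l] clinear_scaleC[OF C])
  then show ?case
    using eigen(2) by (simp add: clinear_add[OF C] clinear_scaleC[OF C]
      clinear_add[OF clinear_op_exp[OF A]] clinear_scaleC[OF clinear_op_exp[OF A]])
qed

text \<open>By induction in both arguments it suffices to compare eigenvectors. Eigenvectors with
  different eigenvalues are \<open>b\<close>-orthogonal, and for equal eigenvalues the exponentials
  agree.\<close>

lemma (in nondegenerate_form) op_exp_symmetric:
  assumes A: "diagonalizable_op A" and sym: "\<And>x y. b (A x) y = b x (A y)"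
  shows "b (op_exp A x) y = b x (op_exp A y)"
  using A
proof (induction x rule: diagonalizable_op_induct)
  case zero
  show ?case by (simp add: zero_left clinear_zero[OF clinear_op_exp[OF A]])
next
  case (eigen c v x l)
  note lin_exp = clinear_op_exp[OF A]
  have "b (op_exp A v) y = b v (op_exp A y)"
    using A
  proof (induction y rule: diagonalizable_op_induct)
    case zero
    show ?case by (simp add: zero_right clinear_zero[OF lin_exp])
  next
    case (eigen d w y m)
    have "l * b v w = m * b v w"
      using sym[of v w] \<open>A v = l *\<^sub>C v\<close> \<open>A w = m *\<^sub>C w\<close> by (simp add: lin lin')
    \<comment> \<open>Either \<open>l = m\<close> or \<open>b v w = 0\<close>.\<close>
    then have "exp l * b v w = exp m * b v w" by auto
    then have "b (op_exp A v) w = b v (op_exp A w)"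
      using op_exp_eigenvector[OF diagonalizable_op_clinear[OF A] \<open>A v = l *\<^sub>C v\<close>]
        op_exp_eigenvector[OF diagonalizable_op_clinear[OF A] \<open>A w = m *\<^sub>C w\<close>]
      by (simp add: lin lin')
    then show ?case
      using eigen(2) by (simp add: lin clinear_add[OF lin_exp] clinear_scaleC[OF lin_exp])
  qed
  then show ?case
    using eigen(2) by (simp add: lin' clinear_add[OF lin_exp] clinear_scaleC[OF lin_exp])
qed

subsection \<open>Orthogonal sums\<close>

lemma orthogonal_sum_commute: "orthogonal_sum V W \<Longrightarrow> orthogonal_sum W V"
  unfolding orthogonal_sum_def by (metis add.commute cinner_commute complex_cnj_zero)

text \<open>Uniqueness is what makes the definite description meaningful: for another candidate
  \<open>u\<close>, the vector \<open>x - u\<close> lies in \<open>V\<close> and is orthogonal to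
  itself.\<close>

lemma orth_proj_add:
  assumes VW: "orthogonal_sum V W" and "x \<in> V" "y \<in> W"
  shows "orth_proj V (x + y) = x"
  unfolding orth_proj_def
proof (rule the_equality)
  show "x \<in> V \<and> (\<forall>z\<in>V. cinner z (x + y - x) = 0)"
    using assms by (simp add: orthogonal_sum_def)
  fix u assume u: "u \<in> V \<and> (\<forall>z\<in>V. cinner z (x + y - u) = 0)"
  have d: "x - u \<in> V"
    using assms u by (simp add: orthogonal_sum_def complex_vector.subspace_diff)
  have "cinner (x - u) (x - u) = cinner (x - u) (x + y - u) - cinner (x - u) y"
    by (simp flip: cinner_diff_right)
  also have "\<dots> = 0" using d u assms by (simp add: orthogonal_sum_def)
  finally show "u = x" by simp
qed

locale orthogonal_decomposition =
  fixes V W :: "'a::fd_complex_hilbert set"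
  assumes orthogonal_sum: "orthogonal_sum V W"
begin

lemma orth_proj_in [simp]: "orth_proj V z \<in> V"
  and orth_proj_sum: "orth_proj V z + orth_proj W z = z"
proof -
  obtain x y where xy: "x \<in> V" "y \<in> W" "z = x + y"
    using orthogonal_sum unfolding orthogonal_sum_def by blast
  then show "orth_proj V z \<in> V" "orth_proj V z + orth_proj W z = z"
    using orth_proj_add[OF orthogonal_sum xy(1,2)]
      orth_proj_add[OF orthogonal_sum_commute[OF orthogonal_sum] xy(2,1)]
    by (simp_all add: add.commute)
qed

end

text \<open>The two summands play symmetric roles; under the prefix \<open>swap\<close>, facts about
  the projector onto \<open>V\<close> become facts about the projector onto
  \<open>W\<close>.\<close>

sublocale orthogonal_decomposition \<subseteq> swap: orthogonal_decomposition W V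
  by unfold_locales (rule orthogonal_sum_commute[OF orthogonal_sum])

context orthogonal_decomposition
begin

lemma subspace: "complex_vector.subspace V"
  using orthogonal_sum by (simp add: orthogonal_sum_def)

lemma orth: "x \<in> V \<Longrightarrow> y \<in> W \<Longrightarrow> cinner x y = 0"
  using orthogonal_sum by (simp add: orthogonal_sum_def)

lemma orth_proj_id [simp]: "x \<in> V \<Longrightarrow> orth_proj V x = x"
  using orth_proj_add[OF orthogonal_sum, of x 0] swap.orthogonal_sum
  by (simp add: orthogonal_sum_def complex_vector.subspace_0)

lemma orth_proj_zero [simp]: "y \<in> W \<Longrightarrow> orth_proj V y = 0"
  using orth_proj_add[OF orthogonal_sum, of 0 y] subspace
  by (simp add: complex_vector.subspace_0)

lemma orth_proj_unique: "x \<in> V \<Longrightarrow> y \<in> W \<Longrightarrow> z = x + y \<Longrightarrow> orth_proj V z = x"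
  using orth_proj_add[OF orthogonal_sum] by simp

end

context orthogonal_decomposition
begin

lemma clinear_orth_proj: "clinear (orth_proj V)"
proof (rule clinearI)
  fix x y c
  have "x + y = (orth_proj V x + orth_proj V y) + (orth_proj W x + orth_proj W y)"
    using orth_proj_sum[of x] orth_proj_sum[of y] by (metis add.assoc add.left_commute)
  then show "orth_proj V (x + y) = orth_proj V x + orth_proj V y"
    by (intro orth_proj_unique) (simp_all add: complex_vector.subspace_add[OF subspace]
        complex_vector.subspace_add[OF swap.subspace])
  have "c *\<^sub>C x = c *\<^sub>C orth_proj V x + c *\<^sub>C orth_proj W x"
    using orth_proj_sum[of x] by (metis complex_vector.scale_right_distrib)
  then show "orth_proj V (c *\<^sub>C x) = c *\<^sub>C orth_proj V x"
    by (intro orth_proj_unique) (simp_all add: complex_vector.subspace_scale[OF subspace]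
        complex_vector.subspace_scale[OF swap.subspace])
qed

lemma cinner_orth_proj_left: "x \<in> V \<Longrightarrow> cinner x (orth_proj V y) = cinner x y"
  using orth[of x "orth_proj W y"] arg_cong[OF orth_proj_sum[of y], of "cinner x"]
  by (simp add: cinner_add_right)

lemma cinner_orth_proj_right: "x \<in> V \<Longrightarrow> cinner (orth_proj V y) x = cinner y x"
  by (metis cinner_orth_proj_left cinner_commute)

lemma orth_proj_self_adjoint: "cinner (orth_proj V x) y = cinner x (orth_proj V y)"
  by (metis cinner_orth_proj_left cinner_orth_proj_right orth_proj_in)

text \<open>Applying \<open>T\<close> to the two components of \<open>x\<close> gives vectors in
  \<open>V\<close> and \<open>W\<close> with sum \<open>T x\<close>, and such a decomposition is
  unique.\<close>

lemma antiunitary_orth_proj: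
  assumes T: "antiunitary_op T" and inv: "T ` V \<subseteq> V" "T ` W \<subseteq> W"
  shows "T (orth_proj V x) = orth_proj V (T x)"
proof -
  have "T x = T (orth_proj V x) + T (orth_proj W x)"
    using T orth_proj_sum[of x] unfolding antiunitary_op_def by metis
  moreover have "T (orth_proj V x) \<in> V" "T (orth_proj W x) \<in> W"
    using inv orth_proj_in swap.orth_proj_in by blast+
  ultimately show ?thesis by (intro orth_proj_unique[symmetric])
qed

end

locale self_adjoint_part = orthogonal_decomposition +
  fixes h
  assumes self_adjoint_on: "self_adjoint_on V h"
begin

lemma extend_zero_in [simp]: "extend_zero V h x \<in> V"
  using self_adjoint_on by (simp add: extend_zero_def self_adjoint_on_def)

lemma clinear_extend_zero: "clinear (extend_zero V h)"
  using self_adjoint_on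
  by (intro clinearI) (simp_all add: extend_zero_def self_adjoint_on_def
    clinear_add[OF clinear_orth_proj] clinear_scaleC[OF clinear_orth_proj])

lemma extend_zero_self_adjoint: "cinner (extend_zero V h x) y = cinner x (extend_zero V h y)"
proof -
  have "cinner (extend_zero V h x) y = cinner (h (orth_proj V x)) (orth_proj V y)"
    using cinner_orth_proj_left[OF extend_zero_in] by (simp add: extend_zero_def)
  also have "\<dots> = cinner (orth_proj V x) (h (orth_proj V y))"
    using self_adjoint_on by (simp add: self_adjoint_on_def)
  also have "\<dots> = cinner x (extend_zero V h y)"
    using cinner_orth_proj_right[OF extend_zero_in] by (simp add: extend_zero_def)
  finally show ?thesis .
qed

end

subsection \<open>Determinants and time reversal\<close>

text \<open>Both sides reduce to \<open>op_det (Z p q)\<close> and \<open>op_det (Z q p)\<close>.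
  The operator \<open>W p q\<close> is the transpose of \<open>Z p q\<close>, all factors being
  symmetric and their order reversed, and \<open>S\<close> conjugates it to
  \<open>Z q p\<close>.\<close>

lemma (in nondegenerate_form) det_counting_symmetric:
  fixes E :: "complex \<Rightarrow> 'a \<Rightarrow> 'a"
  assumes E: "\<And>z. clinear (E z)" "\<And>z w x. E z (E w x) = E (z + w) x" "\<And>x. E 0 x = x"
      "\<And>z x y. b (E z x) y = b x (E z y)"
    and K: "clinear K" "\<And>z x. K (E z x) = E z (K x)" "\<And>x y. b (K x) y = b x (K y)"
    and S: "clinear S" "\<And>x. S' (S x) = x" "\<And>x. S (S' x) = x" "\<And>x. S (K x) = K (S x)"
      "\<And>x y. b (S x) y = b x (S y)"
  shows "op_det (\<lambda>x. K (E (- (p + q)) x) + S' (E p (S (E (- p) x))))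
    = op_det (\<lambda>x. K (E (- (p + q)) x) + S' (E q (S (E (- q) x))))"
proof -
  have S': "clinear S'"
  proof -
    have "S' = inv_into UNIV S"
      using S(2,3) by (intro ext) (metis injI inv_f_eq)
    moreover have "bij S" using S(2,3) by (metis bijI injI surjI)
    ultimately show ?thesis using clinear_inv[OF S(1)] by simp
  qed
  have S'_sym: "b (S' x) y = b x (S' y)" for x y
    by (metis S(3,5))
  define Z where "Z p q x = x + S' (E (- p) (S (K (E (- q) x))))" for p q x
  define W where "W p q x = x + E (- q) (K (S (E (- p) (S' x))))" for p q x
  have Z: "clinear (Z p q)" for p q
    unfolding Z_def by (intro clinear_plus clinear_ident clinear_compose[OF S'] clinear_compose[OF E(1)]
        clinear_compose[OF S(1)] clinear_compose[OF K(1)] E(1))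
  have W: "clinear (W p q)" for p q
    unfolding W_def by (intro clinear_plus clinear_ident clinear_compose[OF S'] clinear_compose[OF E(1)]
        clinear_compose[OF S(1)] clinear_compose[OF K(1)] S')
  have det_S: "op_det S' * op_det S = 1"
    using op_det_compose[OF S', of S] by (simp add: S(2) op_det_ident)
  have det_E: "op_det (E p) * op_det (E (- p)) = 1" for p
    using op_det_compose[OF E(1), of p "E (- p)"] by (simp add: E(2,3) op_det_ident)
  \<comment> \<open>The operator factors as \<open>S' E(p) S Z(p,q) E(-p)\<close>, since
    \<open>K\<close> commutes with \<open>S\<close> and \<open>E\<close>. The outer determinants
    cancel in pairs.\<close>
  have fact: "op_det (\<lambda>x. K (E (- (p + q)) x) + S' (E p (S (E (- p) x)))) = op_det (Z p q)" for p q
  proof -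
    have "K (E (- (p + q)) x) + S' (E p (S (E (- p) x))) = S' (E p (S (Z p q (E (- p) x))))" for x
    proof -
      have "E p (E (- p) (S (K (E (- q) (E (- p) x))))) = S (K (E (- q) (E (- p) x)))"
        by (simp add: E(2,3))
      moreover have "E (- q) (E (- p) x) = E (- (p + q)) x"
        by (simp only: E(2) minus_add)
      ultimately show ?thesis
        by (simp add: Z_def clinear_add[OF S'] clinear_add[OF E(1)] clinear_add[OF S(1)] S(2,3)
          del: minus_add_distrib)
    qed
    then have "op_det (\<lambda>x. K (E (- (p + q)) x) + S' (E p (S (E (- p) x))))
        = op_det (\<lambda>x. S' (E p (S (Z p q (E (- p) x)))))" by presburger
    also have "\<dots> = op_det S' * (op_det (E p) * (op_det S * (op_det (Z p q) * op_det (E (- p)))))"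
      unfolding op_det_compose[OF S', of "\<lambda>x. E p (S (Z p q (E (- p) x)))"]
        op_det_compose[OF E(1), of p "\<lambda>x. S (Z p q (E (- p) x))"]
        op_det_compose[OF S(1), of "\<lambda>x. Z p q (E (- p) x)"]
        op_det_compose[OF Z, of p q "E (- p)"] ..
    also have "\<dots> = (op_det S' * op_det S) * (op_det (E p) * op_det (E (- p))) * op_det (Z p q)"
      by (simp only: ac_simps)
    also have "\<dots> = op_det (Z p q)"
      by (simp only: det_S det_E mult_1_left)
    finally show ?thesis .
  qed
  have "op_det (Z p q) = op_det (W p q)"
    by (rule op_det_transpose[OF Z, symmetric])
      (simp add: W_def Z_def lin lin' E(4) K(3) S(5) S'_sym)
  also have "\<dots> = op_det (Z q p)"
  proof -
    \<comment> \<open>Conjugation turns \<open>E(-q) K S E(-p) S'\<close> into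
      \<open>S' E(-q) K S E(-p)\<close>; commuting \<open>K\<close> with \<open>S\<close> gives the
      form of \<open>Z\<close> with \<open>p\<close> and \<open>q\<close> exchanged.\<close>
    have "Z q p x = S' (W p q (S x))" for x
      by (simp add: Z_def W_def clinear_add[OF S'] S(2,4))
    then have "op_det (Z q p) = op_det (\<lambda>x. S' (W p q (S x)))" by presburger
    also have "\<dots> = op_det S' * (op_det (W p q) * op_det S)"
      unfolding op_det_compose[OF S', of "\<lambda>x. W p q (S x)"] op_det_compose[OF W, of p q S] ..
    also have "\<dots> = op_det (W p q)"
      using det_S by (simp add: mult.left_commute)
    finally show ?thesis by (rule sym)
  qed
  finally show ?thesis
    unfolding fact[of p q] fact[of q p, unfolded add.commute[of q p]] .
qed

text \<open>Antilinearity of \<open>T\<close> cancels the conjugate-linearity of the first slot.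
  Nondegeneracy uses surjectivity: test against an \<open>x\<close> with
  \<open>T x = y\<close>.\<close>

lemma nondegenerate_form_antiunitary:
  fixes T :: "'a::fd_complex_hilbert \<Rightarrow> 'a"
  assumes "antiunitary_op T"
  shows "nondegenerate_form (\<lambda>x y. cinner (T x) y)"
proof
  note T = assms[unfolded antiunitary_op_def]
  fix x y z :: 'a and c
  show "cinner (T x) (y + z) = cinner (T x) y + cinner (T x) z" by (rule cinner_add_right)
  show "cinner (T x) (c *\<^sub>C y) = c * cinner (T x) y" by (rule cinner_scaleC_right)
  show "cinner (T (x + y)) z = cinner (T x) z + cinner (T y) z"
    using T by (simp add: cinner_add_left)
  show "cinner (T (c *\<^sub>C x)) y = c * cinner (T x) y"
    using T by (simp add: cinner_scaleC_left)
next
  fix y assume *: "\<And>x. cinner (T x) y = 0"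
  obtain x where "T x = y" using assms unfolding antiunitary_op_def by (metis bij_pointE)
  with *[of x] show "y = 0" by simp
qed

theorem mainTheorem1:
  fixes V1 V2 :: "'h::fd_complex_hilbert set"
    and h1 h2 S n :: "'h \<Rightarrow> 'h"
    and \<beta> \<mu>1 \<mu>2 :: real
    and F :: "complex \<Rightarrow> complex"
  defines "n \<equiv> occupation V1 V2 h1 h2 \<beta> \<mu>1 \<mu>2"
    and "F \<equiv> levitov_gf V1 n S"
  assumes "orthogonal_sum V1 V2"
    and "self_adjoint_on V1 h1"
    and "self_adjoint_on V2 h2"
    and "\<beta> > 0"
    and "unitary_op S"
    and "\<forall>x. S (extend_zero V1 h1 x + extend_zero V2 h2 x)
              = extend_zero V1 h1 (S x) + extend_zero V2 h2 (S x)"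
    and "\<exists>T. antiunitary_op T \<and> T \<circ> T = id \<and> T ` V1 \<subseteq> V1 \<and> T ` V2 \<subseteq> V2
            \<and> T \<circ> extend_zero V1 h1 \<circ> T = extend_zero V1 h1
            \<and> T \<circ> extend_zero V2 h2 \<circ> T = extend_zero V2 h2
            \<and> T \<circ> S \<circ> T = cadjoint S"
  shows "\<forall>\<kappa>. F (- \<kappa> * complex_of_real (\<beta> * (\<mu>1 - \<mu>2)))
             = F (- (1 - \<kappa>) * complex_of_real (\<beta> * (\<mu>1 - \<mu>2)))"
proof

  \<comment> \<open>Algebra of the projections and Hamiltonians of the two leads\<close>
  fix \<kappa> :: complex
  interpret part1: self_adjoint_part V1 V2 h1
    using assms by unfold_locales
  interpret part2: self_adjoint_part V2 V1 h2
    using assms by unfold_locales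
  define P where "P = orth_proj V1"
  define Q where "Q = orth_proj V2"
  define H1 where "H1 = extend_zero V1 h1"
  define H2 where "H2 = extend_zero V2 h2"
  define H where "H = (\<lambda>x. H1 x + H2 x)"
  obtain T where T: "antiunitary_op T" and TT: "T (T x) = x" and TV: "T ` V1 \<subseteq> V1" "T ` V2 \<subseteq> V2"
    and TH1: "T (H1 (T x)) = H1 x" and TH2: "T (H2 (T x)) = H2 x"
    and TST: "T (S (T x)) = cadjoint S x" for x
    using assms(9) unfolding H1_def H2_def by (auto simp: fun_eq_iff)
  have T_add: "T (x + y) = T x + T y" and T_scale: "T (c *\<^sub>C x) = cnj c *\<^sub>C T x" for x y c
    using T by (simp_all add: antiunitary_op_def)
  have PQ: "P x + Q x = x" for x
    unfolding P_def Q_def by (rule part1.orth_proj_sum)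
  have PP: "P (P x) = P x" "Q (Q x) = Q x" "P (Q x) = 0" "Q (P x) = 0" for x
    unfolding P_def Q_def by simp_all
  have PH: "P (H1 x) = H1 x" "Q (H2 x) = H2 x" "P (H2 x) = 0" "Q (H1 x) = 0" for x
    unfolding P_def Q_def H1_def H2_def by simp_all
  have P: "clinear P" and Q: "clinear Q" and H1: "clinear H1" and H2: "clinear H2"
    unfolding P_def Q_def H1_def H2_def
    by (rule part1.clinear_orth_proj part1.swap.clinear_orth_proj part1.clinear_extend_zero
      part2.clinear_extend_zero)+
  have H: "clinear H" unfolding H_def by (intro clinear_plus H1 H2)
  have HP: "H1 (P x) = H1 x" "H1 (Q x) = 0" "H2 (P x) = 0" "H2 (Q x) = H2 x" for x
    using clinear_zero[OF H1] clinear_zero[OF H2] PP PH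
    by (simp_all add: H1_def H2_def P_def Q_def extend_zero_def
      clinear_zero[OF part1.clinear_orth_proj] clinear_zero[OF part1.swap.clinear_orth_proj])
  have S: "clinear S" and S'S: "cadjoint S (S x) = x" and SS': "S (cadjoint S x) = x" for x
    using assms(7) by (auto simp: unitary_op_def fun_eq_iff)
  have SH: "S (H x) = H (S x)" for x
    using assms(8) by (simp add: H_def H1_def H2_def)

  \<comment> \<open>Joint eigenvectors of the Hamiltonian and the projections\<close>
  define B where "B = {v. (\<exists>l. H v = complex_of_real l *\<^sub>C v)
      \<and> (P v = v \<and> Q v = 0 \<or> P v = 0 \<and> Q v = v)}"
  \<comment> \<open>All exponents below are diagonal on \<open>B\<close>. As \<open>P\<close> and
    \<open>Q\<close> commute with \<open>H\<close>, an eigenvector \<open>v\<close> of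
    \<open>H\<close> splits into \<open>P v\<close> and \<open>Q v\<close>, both in
    \<open>B\<close>; the eigenvectors of \<open>H\<close> span by self-adjointness.\<close>
  have spB: "complex_vector.span B = UNIV"
  proof -
    have sa: "cinner (H x) y = cinner x (H y)" for x y
      by (simp add: H_def H1_def H2_def cinner_add_left cinner_add_right
        part1.extend_zero_self_adjoint part2.extend_zero_self_adjoint)
    have "v \<in> complex_vector.span B" if v: "H v = complex_of_real l *\<^sub>C v" for v l
    proof -
      have "P (H v) = H (P v)" "Q (H v) = H (Q v)"
        by (simp_all add: H_def clinear_add[OF P] clinear_add[OF Q] PH HP)
      then have "P v \<in> B" "Q v \<in> B"
        by (auto simp: B_def PP v clinear_scaleC[OF P] clinear_scaleC[OF Q] intro: HOL.sym)
      then have "P v + Q v \<in> complex_vector.span B"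
        by (intro complex_vector.span_add complex_vector.span_base)
      then show ?thesis by (simp add: PQ)
    qed
    then have "{v. \<exists>l::real. H v = complex_of_real l *\<^sub>C v} \<subseteq> complex_vector.span B" by blast
    from complex_vector.span_mono[OF this] show ?thesis
      by (simp add: self_adjoint_span_eigenvectors[OF H sa] complex_vector.span_span top.extremum_uniqueI)
  qed
  have B_cases: "\<exists>l. H v = complex_of_real l *\<^sub>C v \<and>
      (P v = v \<and> Q v = 0 \<and> H1 v = complex_of_real l *\<^sub>C v \<and> H2 v = 0 \<or>
       P v = 0 \<and> Q v = v \<and> H1 v = 0 \<and> H2 v = complex_of_real l *\<^sub>C v)" if "v \<in> B" for v
  proof -
    obtain l where l: "H v = complex_of_real l *\<^sub>C v" "P v = v \<and> Q v = 0 \<or> P v = 0 \<and> Q v = v"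
      using \<open>v \<in> B\<close> unfolding B_def by blast
    then have "H1 v = 0 \<or> H2 v = 0" "P v = v \<longrightarrow> H2 v = 0" "Q v = v \<longrightarrow> H1 v = 0"
      using HP[of v] by metis+
    then show ?thesis using l by (intro exI[of _ l]) (auto simp: H_def)
  qed

  \<comment> \<open>Exponentials of the counting field and of the Gibbs exponents\<close>
  define E where "E z = op_exp (\<lambda>x. z *\<^sub>C P x)" for z
  define A1 where "A1 = (\<lambda>x. complex_of_real \<beta> *\<^sub>C (H1 x - complex_of_real \<mu>1 *\<^sub>C P x))"
  define A2 where "A2 = (\<lambda>x. complex_of_real \<beta> *\<^sub>C (H2 x - complex_of_real \<mu>2 *\<^sub>C Q x))"
  \<comment> \<open>The potential \<open>\<mu>2\<close> is used on both leads, so that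
    \<open>A\<close> is a function of \<open>H\<close> and commutes with \<open>S\<close>. The
    difference from \<open>A1 + A2\<close> is exactly \<open>a P\<close>.\<close>
  define A where "A = (\<lambda>x. complex_of_real \<beta> *\<^sub>C (H x - complex_of_real \<mu>2 *\<^sub>C x))"
  define K where "K = op_exp A"
  define G where "G = (\<lambda>x. op_exp A1 (op_exp A2 x))"
  define a where "a = complex_of_real (\<beta> * (\<mu>1 - \<mu>2))"
  have linE: "clinear (\<lambda>x. z *\<^sub>C P x)" for z by (intro clinear_scale P)
  have linA1: "clinear A1" unfolding A1_def by (intro clinear_scale clinear_minus H1 P)
  have linA2: "clinear A2" unfolding A2_def by (intro clinear_scale clinear_minus H2 Q)
  have linA: "clinear A" unfolding A_def by (intro clinear_scale clinear_minus H clinear_ident)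
  have diagE: "diagonalizable_op (\<lambda>x. z *\<^sub>C P x)" for z
  proof (rule diagonalizable_opI[OF linE spB])
    fix v assume "v \<in> B"
    then have "z *\<^sub>C P v = z *\<^sub>C v \<or> z *\<^sub>C P v = 0 *\<^sub>C v" by (auto simp: B_def)
    then show "\<exists>l. z *\<^sub>C P v = l *\<^sub>C v" by blast
  qed
  note E_lin = clinear_op_exp[OF diagE, folded E_def]
  \<comment> \<open>\<open>P x\<close> and \<open>Q x\<close> are eigenvectors of \<open>z P\<close>
    with eigenvalues \<open>z\<close> and \<open>0\<close>.\<close>
  have E_formula: "E z x = Q x + exp z *\<^sub>C P x" for z x
  proof -
    have "E z (P x + Q x) = exp z *\<^sub>C P x + exp 0 *\<^sub>C Q x"
      unfolding clinear_add[OF E_lin]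
      using op_exp_eigenvector[OF linE, of z "P x" z] op_exp_eigenvector[OF linE, of z "Q x" 0]
      by (simp add: E_def PP)
    then show ?thesis by (simp add: PQ add.commute)
  qed
  have E_add: "E z (E w x) = E (z + w) x" for z w x
    by (simp add: E_formula clinear_add[OF P] clinear_add[OF Q] clinear_scaleC[OF P] clinear_scaleC[OF Q]
      PP exp_add)
  have E_0: "E 0 x = x" for x
    using PQ[of x] by (simp add: E_formula add.commute)
  have eigA: "A v = (complex_of_real (\<beta> * (l - \<mu>2))) *\<^sub>C v" if "H v = complex_of_real l *\<^sub>C v" for v l
    by (simp add: A_def that complex_vector.scale_left_diff_distrib[symmetric])
  have diagA: "diagonalizable_op A"
    by (rule diagonalizable_opI[OF linA spB]) (use B_cases eigA in blast)
  note K_lin = clinear_op_exp[OF diagA, folded K_def]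
  have KP: "P (K x) = K (P x)" for x
    unfolding K_def
  proof (rule op_exp_commute[OF diagA P])
    fix x
    have "P (H x) = H (P x)" by (simp add: H_def clinear_add[OF P] PH HP)
    then show "P (A x) = A (P x)"
      by (simp add: A_def clinear_scaleC[OF P] clinear_diff[OF P])
  qed
  have KQ: "Q (K x) = K (Q x)" for x
    using PQ[of "K x"] arg_cong[OF PQ[of x], of K] KP[of x]
    by (metis add_left_cancel clinear_add[OF K_lin])
  have KE: "K (E z x) = E z (K x)" for z x
    by (simp add: E_formula clinear_add[OF K_lin] clinear_scaleC[OF K_lin] KP KQ)
  have KS: "S (K x) = K (S x)" for x
    unfolding K_def
    by (rule op_exp_commute[OF diagA S])
      (simp add: A_def clinear_scaleC[OF S] clinear_diff[OF S] SH)

  \<comment> \<open>Gibbs factors and the occupation operator\<close>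
  have eigA12: "\<exists>g::real. g > 0 \<and> G v = complex_of_real g *\<^sub>C v \<and> K (E (- a) v) = complex_of_real g *\<^sub>C v
      \<and> (\<exists>l. A1 v = l *\<^sub>C v) \<and> (\<exists>l. A2 v = l *\<^sub>C v)" if "v \<in> B" for v
  proof -
    obtain l where l: "H v = complex_of_real l *\<^sub>C v"
      "P v = v \<and> Q v = 0 \<and> H1 v = complex_of_real l *\<^sub>C v \<and> H2 v = 0 \<or>
       P v = 0 \<and> Q v = v \<and> H1 v = 0 \<and> H2 v = complex_of_real l *\<^sub>C v"
      using B_cases \<open>v \<in> B\<close> by blast
    have K: "K v = exp (complex_of_real (\<beta> * (l - \<mu>2))) *\<^sub>C v"
      unfolding K_def by (rule op_exp_eigenvector[OF linA eigA[OF l(1)]])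
    from l(2) show ?thesis
    proof
      assume v: "P v = v \<and> Q v = 0 \<and> H1 v = complex_of_real l *\<^sub>C v \<and> H2 v = 0"
      have A: "A1 v = complex_of_real (\<beta> * (l - \<mu>1)) *\<^sub>C v" "A2 v = 0 *\<^sub>C v"
        by (simp_all add: A1_def A2_def v complex_vector.scale_left_diff_distrib[symmetric])
      have "G v = complex_of_real (exp (\<beta> * (l - \<mu>1))) *\<^sub>C v"
        unfolding G_def op_exp_eigenvector[OF linA2 A(2)]
        by (simp add: op_exp_eigenvector[OF linA1 A(1)] exp_of_real[symmetric])
      \<comment> \<open>On the first lead \<open>E (- a)\<close> contributes the factor
        \<open>exp (- a)\<close>, which replaces \<open>\<mu>2\<close> by \<open>\<mu>1\<close> in
        the eigenvalue of \<open>K\<close>.\<close>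
      moreover have "K (E (- a) v) = complex_of_real (exp (\<beta> * (l - \<mu>1))) *\<^sub>C v"
        by (simp add: E_formula v clinear_scaleC[OF K_lin] K a_def exp_of_real[symmetric]
          exp_add[symmetric] algebra_simps)
      ultimately show ?thesis using A by (intro exI[of _ "exp (\<beta> * (l - \<mu>1))"]) auto
    next
      assume v: "P v = 0 \<and> Q v = v \<and> H1 v = 0 \<and> H2 v = complex_of_real l *\<^sub>C v"
      have A: "A1 v = 0 *\<^sub>C v" "A2 v = complex_of_real (\<beta> * (l - \<mu>2)) *\<^sub>C v"
        by (simp_all add: A1_def A2_def v complex_vector.scale_left_diff_distrib[symmetric])
      have A': "A1 (c *\<^sub>C v) = 0 *\<^sub>C (c *\<^sub>C v)" for c by (simp add: clinear_scaleC[OF linA1] A)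
      have "G v = complex_of_real (exp (\<beta> * (l - \<mu>2))) *\<^sub>C v"
        unfolding G_def op_exp_eigenvector[OF linA2 A(2)] op_exp_eigenvector[OF linA1 A']
        by (simp add: exp_of_real[symmetric])
      moreover have "K (E (- a) v) = complex_of_real (exp (\<beta> * (l - \<mu>2))) *\<^sub>C v"
        by (simp add: E_formula v K exp_of_real[symmetric])
      ultimately show ?thesis using A by (intro exI[of _ "exp (\<beta> * (l - \<mu>2))"]) auto
    qed
  qed
  have diagA1: "diagonalizable_op A1"
    by (rule diagonalizable_opI[OF linA1 spB]) (use eigA12 in blast)
  have diagA2: "diagonalizable_op A2"
    by (rule diagonalizable_opI[OF linA2 spB]) (use eigA12 in blast)
  have G: "clinear G"
    unfolding G_def by (rule clinear_compose[OF clinear_op_exp[OF diagA1] clinear_op_exp[OF diagA2]])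
  have G_eq: "G x = K (E (- a) x)" for x
    by (rule clinear_eq_on_spanning[OF G clinear_compose[OF K_lin E_lin] spB])
      (use eigA12 in fastforce)
  define G1 where "G1 = (\<lambda>x. G x + x)"
  have G1: "clinear G1" unfolding G1_def by (intro clinear_plus G clinear_ident)
  \<comment> \<open>On \<open>B\<close> the operator \<open>1 + G\<close> multiplies by
    \<open>g + 1 > 0\<close>. It is therefore surjective, hence bijective, and \<open>n\<close> is
    its true inverse.\<close>
  have "x \<in> range G1" for x
  proof -
    have "x \<in> complex_vector.span B" using spB by simp
    then show ?thesis
    proof (induction rule: complex_vector.span_induct_alt)
      case base
      show ?case using clinear_zero[OF G1] by (metis rangeI)
    next
      case (step c v y)
      obtain g :: real where g: "g > 0" "G v = complex_of_real g *\<^sub>C v" using eigA12 step(1) by blast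
      have "complex_of_real (g + 1) \<noteq> 0" using g(1) by (simp only: of_real_eq_0_iff)
      moreover have "G1 v = complex_of_real (g + 1) *\<^sub>C v"
        by (simp add: G1_def g complex_vector.scale_left_distrib)
      ultimately have "G1 ((c / complex_of_real (g + 1)) *\<^sub>C v) = c *\<^sub>C v"
        by (simp add: clinear_scaleC[OF G1])
      moreover obtain w where "y = G1 w" using step(2) by blast
      ultimately have "c *\<^sub>C v + y = G1 ((c / complex_of_real (g + 1)) *\<^sub>C v + w)"
        by (simp add: clinear_add[OF G1])
      then show ?case by blast
    qed
  qed
  then have "surj G1" by blast
  then have bijG1: "bij G1" using clinear_surj_imp_inj[OF G1] by (simp add: bij_def)
  have n: "n = inv_into UNIV G1"
    unfolding n_def occupation_def gibbs_factor_def G1_def G_def A1_def A2_def H1_def H2_def P_def Q_def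
    by (simp add: scaleR_scaleC)
  \<comment> \<open>Multiplication by \<open>1 + G\<close> clears the inverse:
    \<open>(1 + G)(1 + n (M - 1)) = G + M\<close>.\<close>
  have F: "op_det G1 * F (- p) = op_det (\<lambda>x. K (E (- a) x) + cadjoint S (E p (S (E (- p) x))))" for p
  proof -
    let ?M = "\<lambda>x. cadjoint S (E p (S (E (- p) x)))"
    have "F (- p) = op_det (\<lambda>x. x + n (?M x - x))"
      unfolding F_def levitov_gf_def E_def P_def by simp
    then have "op_det G1 * F (- p) = op_det (\<lambda>x. G1 (x + n (?M x - x)))"
      using op_det_compose[OF G1, of "\<lambda>x. x + n (?M x - x)"] by simp
    also have "(\<lambda>x. G1 (x + n (?M x - x))) = (\<lambda>x. K (E (- a) x) + ?M x)"
      using \<open>surj G1\<close> by (simp add: clinear_add[OF G1] n surj_f_inv_f) (simp add: G1_def G_eq)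
    finally show ?thesis .
  qed

  \<comment> \<open>Symmetry of all factors under the time-reversal form\<close>
  interpret nondegenerate_form "\<lambda>x y. cinner (T x) y"
    by (rule nondegenerate_form_antiunitary[OF T])
  have P_sym: "cinner (T (P x)) y = cinner (T x) (P y)" for x y
    unfolding P_def part1.antiunitary_orth_proj[OF T TV] by (rule part1.orth_proj_self_adjoint)
  have E_sym: "cinner (T (E z x)) y = cinner (T x) (E z y)" for z x y
    unfolding E_def
    by (rule op_exp_symmetric[OF diagE]) (simp add: T_scale cinner_scaleC_left cinner_scaleC_right P_sym)
  have H_sym: "cinner (T (H x)) y = cinner (T x) (H y)" for x y
  proof -
    have "T (H1 x) = H1 (T x)" "T (H2 x) = H2 (T x)"
      using TH1[of "T x"] TH2[of "T x"] by (simp_all add: TT)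
    then show ?thesis
      by (simp add: H_def T_add cinner_add_left cinner_add_right)
        (simp add: H1_def H2_def part1.extend_zero_self_adjoint part2.extend_zero_self_adjoint)
  qed
  have A_sym: "cinner (T (A x)) y = cinner (T x) (A y)" for x y
  proof -
    have "A x = complex_of_real \<beta> *\<^sub>C H x + (- complex_of_real (\<beta> * \<mu>2)) *\<^sub>C x" for x
      by (simp add: A_def complex_vector.scale_right_diff_distrib)
    then show ?thesis
      by (simp only: lin lin' H_sym)
  qed
  have S_sym: "cinner (T (S x)) y = cinner (T x) (S y)" for x y
  proof -
    \<comment> \<open>Time reversal turns \<open>S\<close> into its adjoint, and moving the adjoint
      across the inner product restores \<open>S\<close>.\<close>
    have "T (S x) = cadjoint S (T x)" using TST[of "T x"] by (simp add: TT)
    then show ?thesis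
      by (metis cinner_cadjoint[OF S] cinner_commute)
  qed
  \<comment> \<open>With \<open>p + q = a\<close>, exchanging \<open>p\<close> and \<open>q\<close>
    is the substitution of \<open>1 - \<kappa>\<close> for \<open>\<kappa>\<close>.\<close>
  define p where "p = \<kappa> * a"
  define q where "q = (1 - \<kappa>) * a"
  have "- a = - (p + q)" by (simp add: p_def q_def algebra_simps)
  have "op_det G1 * F (- p) = op_det G1 * F (- q)"
    unfolding F \<open>- a = - (p + q)\<close>
    by (rule det_counting_symmetric[OF E_lin E_add E_0 E_sym K_lin KE _ S S'S SS' KS S_sym])
      (unfold K_def, rule op_exp_symmetric[OF diagA A_sym])
  then have "F (- p) = F (- q)" using op_det_nonzero[OF G1 bijG1] by simp
  then show "F (- \<kappa> * complex_of_real (\<beta> * (\<mu>1 - \<mu>2)))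
      = F (- (1 - \<kappa>) * complex_of_real (\<beta> * (\<mu>1 - \<mu>2)))"
    unfolding p_def q_def a_def by (simp only: mult_minus_left)
qed

end
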